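(* Let $X$ be a set and let $\mathcal P(X)$ be the semiring $(\mathcal P(X),\cup,\cap,\varnothing,X)$. Then every congruence on $\mathcal P(X)$ is a $z$-congruence. Moreover every ideal of $\mathcal P(X)$ is $g$-closed.
   Context: In the semiring $\mathcal P(X)$, addition is $\cup$, multiplication is $\cap$, $0=\varnothing$, $1=X$. An ideal of a commutative semiring $S$ is a non-empty subset closed under addition and under multiplication by arbitrary elements of $S$. A congruence on $S$ is an equivalence relation compatible with $+$ and $\cdot$; it is proper if $\neq S\times S$; maximal congruences are maximal among proper congruences, and $\mathrm{MaxCong}(S)$ is the set of these. For $(a,b)\in S\times S$ put $\mathcal M_{\mathcal C}(a,b)=\{\theta\in\mathrm{MaxCong}(S)\mid(a,b)\in\theta\}$. A congruence $\rho$ is a $z$-congruence if $(a,b)\in\rho$ and $\mathcal M_{\mathcal C}(a,b)\subseteq\mathcal M_{\mathcal C}(c,d)$ imply $(c,d)\in\rho$. The zero-class of $\theta$ is $0_\theta=\{a\in S\mid(a,0)\in\theta\}$. For an ideal $I$, $\wp_I$ is the intersection of all maximal congruences $\theta$ with $I\subseteq0_\theta$ (equal to $S\times S$ if there are none), $I^g=0_{\wp_I}$, and $I$ is $g$-closed if $I=I^g$. *)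

theory Defs
  imports "HOL-Algebra.Ring"
begin

definition powerset_semiring :: "'a set \<Rightarrow> 'a set ring"
  where "powerset_semiring X =
    \<lparr>carrier = Pow X, mult = (\<inter>), one = X, zero = {}, add = (\<union>)\<rparr>"

lemma powerset_semiring_is_semiring: "semiring (powerset_semiring X)"
  by unfold_locales (auto simp: powerset_semiring_def Units_def)

lemma powerset_semiring_is_comm_monoid: "comm_monoid (powerset_semiring X)"
  by unfold_locales (auto simp: powerset_semiring_def)

text \<open>The remaining notions are intended for commutative semirings, i.e. structures \<open>S\<close> with
  both \<^term>\<open>semiring S\<close> and \<^term>\<open>comm_monoid S\<close>. The library's \<^const>\<open>equiv\<close> includes
  that the relation is contained in \<open>carrier S \<times> carrier S\<close>.\<close>

definition semiring_ideal :: "('a, 'm) ring_scheme \<Rightarrow> 'a set \<Rightarrow> bool"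
  where "semiring_ideal S I \<longleftrightarrow>
    I \<subseteq> carrier S \<and> I \<noteq> {} \<and>
    (\<forall>a\<in>I. \<forall>b\<in>I. a \<oplus>\<^bsub>S\<^esub> b \<in> I) \<and>
    (\<forall>s\<in>carrier S. \<forall>a\<in>I. s \<otimes>\<^bsub>S\<^esub> a \<in> I)"

definition semiring_congruence :: "('a, 'm) ring_scheme \<Rightarrow> ('a \<times> 'a) set \<Rightarrow> bool"
  where "semiring_congruence S \<rho> \<longleftrightarrow>
    equiv (carrier S) \<rho> \<and>
    (\<forall>a b c d. (a, b) \<in> \<rho> \<longrightarrow> (c, d) \<in> \<rho> \<longrightarrow>
      (a \<oplus>\<^bsub>S\<^esub> c, b \<oplus>\<^bsub>S\<^esub> d) \<in> \<rho> \<and> (a \<otimes>\<^bsub>S\<^esub> c, b \<otimes>\<^bsub>S\<^esub> d) \<in> \<rho>)"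

definition proper_congruence :: "('a, 'm) ring_scheme \<Rightarrow> ('a \<times> 'a) set \<Rightarrow> bool"
  where "proper_congruence S \<rho> \<longleftrightarrow>
    semiring_congruence S \<rho> \<and> \<rho> \<noteq> carrier S \<times> carrier S"

definition MaxCong :: "('a, 'm) ring_scheme \<Rightarrow> ('a \<times> 'a) set set"
  where "MaxCong S = {\<theta>. proper_congruence S \<theta> \<and>
    (\<forall>\<sigma>. proper_congruence S \<sigma> \<longrightarrow> \<theta> \<subseteq> \<sigma> \<longrightarrow> \<sigma> = \<theta>)}"

definition max_congs_containing :: "('a, 'm) ring_scheme \<Rightarrow> 'a \<Rightarrow> 'a \<Rightarrow> ('a \<times> 'a) set set"
  where "max_congs_containing S a b = {\<theta> \<in> MaxCong S. (a, b) \<in> \<theta>}"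

definition z_congruence :: "('a, 'm) ring_scheme \<Rightarrow> ('a \<times> 'a) set \<Rightarrow> bool"
  where "z_congruence S \<rho> \<longleftrightarrow>
    semiring_congruence S \<rho> \<and>
    (\<forall>a\<in>carrier S. \<forall>b\<in>carrier S. \<forall>c\<in>carrier S. \<forall>d\<in>carrier S.
      (a, b) \<in> \<rho> \<longrightarrow> max_congs_containing S a b \<subseteq> max_congs_containing S c d \<longrightarrow>
      (c, d) \<in> \<rho>)"

definition zero_class :: "('a, 'm) ring_scheme \<Rightarrow> ('a \<times> 'a) set \<Rightarrow> 'a set"
  where "zero_class S \<theta> = {a \<in> carrier S. (a, \<zero>\<^bsub>S\<^esub>) \<in> \<theta>}"

text \<open>Intersecting with \<open>carrier S \<times> carrier S\<close> only matters when no maximal congruence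
  qualifies; it makes the empty intersection equal to \<open>carrier S \<times> carrier S\<close>.\<close>

definition ideal_congruence :: "('a, 'm) ring_scheme \<Rightarrow> 'a set \<Rightarrow> ('a \<times> 'a) set"
  where "ideal_congruence S I =
    (carrier S \<times> carrier S) \<inter> \<Inter> {\<theta> \<in> MaxCong S. I \<subseteq> zero_class S \<theta>}"

definition g_closure :: "('a, 'm) ring_scheme \<Rightarrow> 'a set \<Rightarrow> 'a set"
  where "g_closure S I = zero_class S (ideal_congruence S I)"

definition g_closed :: "('a, 'm) ring_scheme \<Rightarrow> 'a set \<Rightarrow> bool"
  where "g_closed S I \<longleftrightarrow> I = g_closure S I"

end

(* In a power set, (a, b) lies in a congruence iff (sym_diff a b, {}) does, so congruences are
   determined by their zero-classes, and maximal congruences correspond to prime ideals.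
   For the z-property the principal prime ideals Pow (X - {x}) already suffice: a point x of
   sym_diff c d outside sym_diff a b yields a maximal congruence containing (a, b) but not (c, d).
   For g-closedness, an ideal maximal among those containing I and avoiding a given a outside I
   is prime. *)

theory Submission
  imports Defs
begin

section \<open>Ideals and congruences of a power set\<close>

lemma powerset_semiring_simps [simp]:
  "carrier (powerset_semiring X) = Pow X"
  "A \<oplus>\<^bsub>powerset_semiring X\<^esub> B = A \<union> B"
  "A \<otimes>\<^bsub>powerset_semiring X\<^esub> B = A \<inter> B"
  "\<zero>\<^bsub>powerset_semiring X\<^esub> = {}"
  by (simp_all add: powerset_semiring_def)

text \<open>Every \<open>B \<subseteq> A\<close> equals \<open>B \<inter> A\<close>, so absorption
  under multiplication amounts to closure under subsets, and non-emptiness then puts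
  \<open>{}\<close> into the ideal. Later arguments work with this order-theoretic form.\<close>

lemma semiring_ideal_powerset_iff:
  "semiring_ideal (powerset_semiring X) I \<longleftrightarrow>
    I \<subseteq> Pow X \<and> {} \<in> I \<and> (\<forall>A\<in>I. \<forall>B\<in>I. A \<union> B \<in> I) \<and> (\<forall>A\<in>I. \<forall>B. B \<subseteq> A \<longrightarrow> B \<in> I)"
  (is "?L \<longleftrightarrow> ?R")
proof
  assume L: ?L
  have down: "B \<in> I" if "A \<in> I" "B \<subseteq> A" for A B
  proof -
    have "B \<subseteq> X"
      using L that by (auto simp: semiring_ideal_def)
    then have "B \<inter> A \<in> I"
      using L that(1) by (simp add: semiring_ideal_def)
    then show ?thesis
      using that(2) by (simp add: Int_absorb2)
  qed
  moreover have "{} \<in> I"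
    using L down by (auto simp: semiring_ideal_def)
  ultimately show ?R
    using L by (auto simp: semiring_ideal_def)
next
  assume ?R
  then show ?L
    by (auto simp: semiring_ideal_def)
qed

text \<open>Complements replace the missing subtraction: intersecting a pair \<open>(C, D)\<close>
  with \<open>X - D\<close> turns it into \<open>(C - D, {})\<close>. Conversely, if
  \<open>sym_diff A B\<close> is congruent to zero, joining it to \<open>A\<close> or to
  \<open>B\<close> changes neither class, and both joins equal \<open>A \<union> B\<close>.\<close>

lemma congruence_powerset_sym_diff_iff:
  assumes cong: "semiring_congruence (powerset_semiring X) \<rho>" and "A \<subseteq> X" "B \<subseteq> X"
  shows "(A, B) \<in> \<rho> \<longleftrightarrow> (sym_diff A B, {}) \<in> \<rho>"
proof -
  have eq: "equiv (Pow X) \<rho>"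
    and un: "\<And>a b c d. (a, b) \<in> \<rho> \<Longrightarrow> (c, d) \<in> \<rho> \<Longrightarrow> (a \<union> c, b \<union> d) \<in> \<rho>"
    and int: "\<And>a b c d. (a, b) \<in> \<rho> \<Longrightarrow> (c, d) \<in> \<rho> \<Longrightarrow> (a \<inter> c, b \<inter> d) \<in> \<rho>"
    using cong by (simp_all add: semiring_congruence_def)
  have refl: "(C, C) \<in> \<rho>" if "C \<subseteq> X" for C
    using eq that by (simp add: equiv_def refl_on_def)
  have sym: "(C, D) \<in> \<rho>" if "(D, C) \<in> \<rho>" for C D
    using eq that by (meson equiv_def symD)
  have diff: "(C - D, {}) \<in> \<rho>" if "(C, D) \<in> \<rho>" "C \<subseteq> X" "D \<subseteq> X" for C D
  proof -
    have "(C \<inter> (X - D), D \<inter> (X - D)) \<in> \<rho>"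
      using that by (intro int refl) auto
    moreover have "C \<inter> (X - D) = C - D" "D \<inter> (X - D) = {}"
      using that by auto
    ultimately show ?thesis by simp
  qed
  show ?thesis
  proof
    assume "(A, B) \<in> \<rho>"
    \<comment> \<open>The second use of \<open>diff\<close> is for the reversed pair
      \<open>(B, A)\<close>; the union of the two results is the symmetric difference.\<close>
    then show "(sym_diff A B, {}) \<in> \<rho>"
      using un[OF diff diff, OF _ _ _ sym] assms(2,3) by simp
  next
    assume *: "(sym_diff A B, {}) \<in> \<rho>"
    have "(A \<union> sym_diff A B, A) \<in> \<rho>" "(B \<union> sym_diff A B, B) \<in> \<rho>"
      using un[OF refl *, of A] un[OF refl *, of B] assms(2,3) by simp_all
    moreover have "A \<union> sym_diff A B = B \<union> sym_diff A B"
      by auto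
    ultimately show "(A, B) \<in> \<rho>"
      using eq sym by (metis equiv_def transD)
  qed
qed

lemma semiring_ideal_zero_class:
  assumes cong: "semiring_congruence (powerset_semiring X) \<rho>"
  shows "semiring_ideal (powerset_semiring X) (zero_class (powerset_semiring X) \<rho>)"
proof -
  have eq: "equiv (Pow X) \<rho>"
    and un: "\<And>a b c d. (a, b) \<in> \<rho> \<Longrightarrow> (c, d) \<in> \<rho> \<Longrightarrow> (a \<union> c, b \<union> d) \<in> \<rho>"
    and int: "\<And>a b c d. (a, b) \<in> \<rho> \<Longrightarrow> (c, d) \<in> \<rho> \<Longrightarrow> (a \<inter> c, b \<inter> d) \<in> \<rho>"
    using cong by (simp_all add: semiring_congruence_def)
  have refl: "(C, C) \<in> \<rho>" if "C \<subseteq> X" for C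
    using eq that by (simp add: equiv_def refl_on_def)
  have "A \<union> B \<in> zero_class (powerset_semiring X) \<rho>"
    if "A \<in> zero_class (powerset_semiring X) \<rho>" "B \<in> zero_class (powerset_semiring X) \<rho>" for A B
    using un[of A "{}" B "{}"] that by (simp add: zero_class_def)
  moreover have "C \<inter> A \<in> zero_class (powerset_semiring X) \<rho>"
    if "C \<subseteq> X" "A \<in> zero_class (powerset_semiring X) \<rho>" for A C
    using int[OF refl[OF \<open>C \<subseteq> X\<close>], of A "{}"] that by (simp add: zero_class_def le_infI1)
  moreover have "{} \<in> zero_class (powerset_semiring X) \<rho>"
    using refl by (simp add: zero_class_def)
  ultimately show ?thesis
    unfolding semiring_ideal_def by (auto simp: zero_class_def)
qed

section \<open>Maximal congruences from prime ideals\<close>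

text \<open>Symmetric difference is addition in the Boolean ring on \<open>Pow X\<close>, so for an
  ideal \<open>J\<close> this is congruence modulo \<open>J\<close> in that ring. The bounds by
  \<open>X\<close> keep the relation inside the carrier, as \<open>equiv\<close> demands.\<close>

definition sym_diff_congruence :: "'a set \<Rightarrow> 'a set set \<Rightarrow> ('a set \<times> 'a set) set"
  where "sym_diff_congruence X J = {(A, B). A \<subseteq> X \<and> B \<subseteq> X \<and> sym_diff A B \<in> J}"

text \<open>Transitivity is the triangle inequality for symmetric differences. Compatibility holds
  because the symmetric difference of two unions, or of two intersections, is covered by the union
  of the symmetric differences of the arguments.\<close>

lemma semiring_congruence_sym_diff_congruence:
  assumes "semiring_ideal (powerset_semiring X) J"
  shows "semiring_congruence (powerset_semiring X) (sym_diff_congruence X J)"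
proof -
  have empty: "{} \<in> J"
    and un: "\<And>A B. A \<in> J \<Longrightarrow> B \<in> J \<Longrightarrow> A \<union> B \<in> J"
    and down: "\<And>A B. A \<in> J \<Longrightarrow> B \<subseteq> A \<Longrightarrow> B \<in> J"
    using assms by (auto simp: semiring_ideal_powerset_iff)
  have "equiv (Pow X) (sym_diff_congruence X J)"
  proof (rule equivI)
    show "sym (sym_diff_congruence X J)"
      by (auto simp: sym_def sym_diff_congruence_def Un_commute)
    show "trans (sym_diff_congruence X J)"
    proof (rule transI)
      fix A B C
      assume "(A, B) \<in> sym_diff_congruence X J" "(B, C) \<in> sym_diff_congruence X J"
      moreover have "sym_diff A C \<subseteq> sym_diff A B \<union> sym_diff B C"
        by auto
      ultimately show "(A, C) \<in> sym_diff_congruence X J"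
        using down[OF un, of "sym_diff A B" "sym_diff B C" "sym_diff A C"]
        unfolding sym_diff_congruence_def by blast
    qed
  qed (auto simp: refl_on_def sym_diff_congruence_def empty)
  moreover have "(A \<union> C, B \<union> D) \<in> sym_diff_congruence X J \<and>
      (A \<inter> C, B \<inter> D) \<in> sym_diff_congruence X J"
    if "(A, B) \<in> sym_diff_congruence X J" "(C, D) \<in> sym_diff_congruence X J" for A B C D
  proof -
    have J: "sym_diff A B \<union> sym_diff C D \<in> J"
      using that un[of "sym_diff A B" "sym_diff C D"] by (simp add: sym_diff_congruence_def)
    have "sym_diff (A \<union> C) (B \<union> D) \<in> J" "sym_diff (A \<inter> C) (B \<inter> D) \<in> J"
      by (rule down[OF J], blast)+
    then show ?thesis
      using that unfolding sym_diff_congruence_def by blast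
  qed
  ultimately show ?thesis
    unfolding semiring_congruence_def by simp
qed

text \<open>A strictly larger congruence relates some \<open>A\<close> and \<open>B\<close> with
  \<open>D = sym_diff A B\<close> outside \<open>J\<close>. Then \<open>X - D\<close> lies in
  \<open>J\<close>, so both \<open>D\<close> and its complement are congruent to zero. Hence so is
  \<open>X\<close>, with all its subsets, and the larger congruence is not proper.\<close>

lemma sym_diff_congruence_in_MaxCong:
  assumes J: "semiring_ideal (powerset_semiring X) J" and "X \<notin> J"
    and prime: "\<And>A. A \<subseteq> X \<Longrightarrow> A \<in> J \<or> X - A \<in> J"
  shows "sym_diff_congruence X J \<in> MaxCong (powerset_semiring X)"
proof -
  let ?P = "powerset_semiring X" and ?\<theta> = "sym_diff_congruence X J"
  have "(X, {}) \<notin> ?\<theta>"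
    using \<open>X \<notin> J\<close> by (simp add: sym_diff_congruence_def)
  then have "proper_congruence ?P ?\<theta>"
    using semiring_congruence_sym_diff_congruence[OF J] by (auto simp: proper_congruence_def)
  moreover have "\<sigma> = ?\<theta>" if \<sigma>: "proper_congruence ?P \<sigma>" and sub: "?\<theta> \<subseteq> \<sigma>" for \<sigma>
  proof (rule ccontr)
    have cong: "semiring_congruence ?P \<sigma>" and "\<sigma> \<noteq> Pow X \<times> Pow X"
      using \<sigma> by (auto simp: proper_congruence_def)
    have sub_Pow: "\<sigma> \<subseteq> Pow X \<times> Pow X"
      using cong by (auto simp: semiring_congruence_def equiv_def)
    have ideal: "semiring_ideal ?P (zero_class ?P \<sigma>)"
      using cong by (rule semiring_ideal_zero_class)
    assume "\<sigma> \<noteq> ?\<theta>"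
    then obtain A B where AB: "(A, B) \<in> \<sigma>" "(A, B) \<notin> ?\<theta>"
      using sub by auto
    have X: "A \<subseteq> X" "B \<subseteq> X"
      using AB sub_Pow by auto
    define D where "D = sym_diff A B"
    have "D \<subseteq> X" "D \<notin> J"
      using AB X by (auto simp: D_def sym_diff_congruence_def)
    then have "(X - D, {}) \<in> ?\<theta>"
      using prime by (auto simp: sym_diff_congruence_def)
    then have "X - D \<in> zero_class ?P \<sigma>"
      using sub by (auto simp: zero_class_def)
    moreover have "D \<in> zero_class ?P \<sigma>"
      using AB(1) \<open>D \<subseteq> X\<close> congruence_powerset_sym_diff_iff[OF cong X]
      by (simp add: zero_class_def D_def)
    ultimately have "D \<union> (X - D) \<in> zero_class ?P \<sigma>"
      using ideal unfolding semiring_ideal_powerset_iff by blast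
    then have "X \<in> zero_class ?P \<sigma>"
      using \<open>D \<subseteq> X\<close> by (simp add: Un_absorb1)
    then have zero: "C \<in> zero_class ?P \<sigma>" if "C \<subseteq> X" for C
      using ideal that by (simp add: semiring_ideal_powerset_iff)
    have "(C, E) \<in> \<sigma>" if "C \<subseteq> X" "E \<subseteq> X" for C E
    proof -
      have "sym_diff C E \<subseteq> X"
        using that by auto
      from zero[OF this] show ?thesis
        using congruence_powerset_sym_diff_iff[OF cong that] by (simp add: zero_class_def)
    qed
    with sub_Pow \<open>\<sigma> \<noteq> Pow X \<times> Pow X\<close> show False
      by auto
  qed
  ultimately show ?thesis
    by (simp add: MaxCong_def)
qed

section \<open>Every congruence is a z-congruence\<close>

lemma z_congruence_powerset:
  assumes cong: "semiring_congruence (powerset_semiring X) \<rho>"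
  shows "z_congruence (powerset_semiring X) \<rho>"
proof -
  let ?P = "powerset_semiring X"
  have "(C, D) \<in> \<rho>"
    if X: "A \<subseteq> X" "B \<subseteq> X" "C \<subseteq> X" "D \<subseteq> X" and AB: "(A, B) \<in> \<rho>"
      and sub: "max_congs_containing ?P A B \<subseteq> max_congs_containing ?P C D" for A B C D
  proof -
    have "sym_diff C D \<subseteq> sym_diff A B"
    proof
      fix x assume x: "x \<in> sym_diff C D"
      show "x \<in> sym_diff A B"
      proof (rule ccontr)
        assume "x \<notin> sym_diff A B"
        \<comment> \<open>This congruence relates two subsets of \<open>X\<close> exactly when they
          agree on whether \<open>x\<close> belongs to them, so it separates \<open>C\<close> from
          \<open>D\<close> but not \<open>A\<close> from \<open>B\<close>.\<close>
        let ?\<theta> = "sym_diff_congruence X (Pow (X - {x}))"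
        have "?\<theta> \<in> MaxCong ?P"
        proof (rule sym_diff_congruence_in_MaxCong)
          show "semiring_ideal ?P (Pow (X - {x}))"
            by (auto simp: semiring_ideal_powerset_iff)
        qed (use x X in auto)
        moreover have "(A, B) \<in> ?\<theta>"
          using X \<open>x \<notin> sym_diff A B\<close> by (auto simp: sym_diff_congruence_def)
        ultimately have "(C, D) \<in> ?\<theta>"
          using sub by (auto simp: max_congs_containing_def)
        then show False
          using x by (auto simp: sym_diff_congruence_def)
      qed
    qed
    moreover have "sym_diff A B \<in> zero_class ?P \<rho>"
      using AB X congruence_powerset_sym_diff_iff[OF cong X(1,2)]
      by (auto simp: zero_class_def)
    ultimately have "sym_diff C D \<in> zero_class ?P \<rho>"
      using semiring_ideal_zero_class[OF cong] unfolding semiring_ideal_powerset_iff by blast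
    then show ?thesis
      using congruence_powerset_sym_diff_iff[OF cong X(3,4)] by (simp add: zero_class_def)
  qed
  then show ?thesis
    using cong unfolding z_congruence_def powerset_semiring_simps by blast
qed

section \<open>Prime ideals and g-closed ideals\<close>

text \<open>This is the Boolean prime ideal theorem in separation form, obtained from Zorn's lemma.
  Primality is stated through complements, the form in which maximality of the congruence is
  proved.\<close>

lemma prime_ideal_avoiding_exists:
  assumes I: "semiring_ideal (powerset_semiring X) I" and "a \<subseteq> X" "a \<notin> I"
  obtains J where "semiring_ideal (powerset_semiring X) J" "I \<subseteq> J" "a \<notin> J"
    "\<And>A. A \<subseteq> X \<Longrightarrow> A \<in> J \<or> X - A \<in> J"
proof -
  let ?P = "powerset_semiring X"
  define F where "F = {J. semiring_ideal ?P J \<and> I \<subseteq> J \<and> a \<notin> J}"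
  have "\<exists>J\<in>F. \<forall>K\<in>F. J \<subseteq> K \<longrightarrow> K = J"
  proof (rule subset_Zorn_nonempty)
    show "F \<noteq> {}"
      using assms by (auto simp: F_def)
  next
    fix \<C> assume "\<C> \<noteq> {}" and chain: "subset.chain F \<C>"
    have mem: "semiring_ideal ?P J" "I \<subseteq> J" "a \<notin> J" if "J \<in> \<C>" for J
      using chain that by (auto simp: subset.chain_def F_def)
    have "A \<union> B \<in> \<Union>\<C>" if "A \<in> \<Union>\<C>" "B \<in> \<Union>\<C>" for A B
    proof -
      obtain J K where "J \<in> \<C>" "K \<in> \<C>" "A \<in> J" "B \<in> K"
        using \<open>A \<in> \<Union>\<C>\<close> \<open>B \<in> \<Union>\<C>\<close> by blast
      \<comment> \<open>Comparability in the chain puts \<open>A\<close> and \<open>B\<close> into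
        one common member, which is closed under unions.\<close>
      moreover from this have "J \<subseteq> K \<or> K \<subseteq> J"
        using chain by (auto simp: subset_chain_def)
      ultimately obtain L where "L \<in> \<C>" "A \<in> L" "B \<in> L"
        by blast
      with mem(1)[of L] show ?thesis
        unfolding semiring_ideal_powerset_iff by blast
    qed
    moreover have "\<Union>\<C> \<subseteq> Pow X" "{} \<in> \<Union>\<C>" "\<forall>A\<in>\<Union>\<C>. \<forall>B. B \<subseteq> A \<longrightarrow> B \<in> \<Union>\<C>"
      using mem(1) \<open>\<C> \<noteq> {}\<close> unfolding semiring_ideal_powerset_iff by blast+
    ultimately have "semiring_ideal ?P (\<Union>\<C>)"
      by (simp add: semiring_ideal_powerset_iff)
    then show "\<Union>\<C> \<in> F"
      using mem(2,3) \<open>\<C> \<noteq> {}\<close> unfolding F_def by blast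
  qed
  then obtain J where "J \<in> F" and max: "\<And>K. K \<in> F \<Longrightarrow> J \<subseteq> K \<Longrightarrow> K = J"
    by blast
  then have J: "semiring_ideal ?P J" "I \<subseteq> J" "a \<notin> J"
    by (auto simp: F_def)
  then have "J \<subseteq> Pow X" "{} \<in> J"
    and un: "\<And>A B. A \<in> J \<Longrightarrow> B \<in> J \<Longrightarrow> A \<union> B \<in> J"
    and down: "\<And>A B. A \<in> J \<Longrightarrow> B \<subseteq> A \<Longrightarrow> B \<in> J"
    by (auto simp: semiring_ideal_powerset_iff)
  \<comment> \<open>Maximality in usable form: enlarging \<open>J\<close> by an outside set
    \<open>A\<close> must capture \<open>a\<close>, which says that the part of \<open>a\<close>
    beyond \<open>A\<close> lies in \<open>J\<close>.\<close>
  have extend: "a - A \<in> J" if "A \<subseteq> X" "A \<notin> J" for A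
  proof (rule ccontr)
    assume "a - A \<notin> J"
    \<comment> \<open>the ideal generated by \<open>J\<close> and \<open>A\<close>\<close>
    define K where "K = {B. B \<subseteq> X \<and> B - A \<in> J}"
    have "semiring_ideal ?P K"
      unfolding semiring_ideal_powerset_iff
    proof (intro conjI ballI allI impI)
      show "C \<in> K" if "B \<in> K" "C \<subseteq> B" for B C
        using that down[of "B - A" "C - A"] by (auto simp: K_def)
    qed (auto simp: K_def Un_Diff \<open>{} \<in> J\<close> un)
    moreover have "J \<subseteq> K"
      using \<open>J \<subseteq> Pow X\<close> down[OF _ Diff_subset] by (auto simp: K_def)
    \<comment> \<open>Since \<open>a - A\<close> is outside \<open>J\<close>, the set
      \<open>a\<close> is outside \<open>K\<close>; thus \<open>K\<close> belongs to
      \<open>F\<close> and maximality of \<open>J\<close> applies.\<close>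
    ultimately have "K = J"
      using J \<open>a - A \<notin> J\<close> by (intro max) (auto simp: F_def K_def)
    moreover have "A \<in> K"
      using \<open>A \<subseteq> X\<close> \<open>{} \<in> J\<close> by (simp add: K_def)
    ultimately show False
      using \<open>A \<notin> J\<close> by simp
  qed
  have "A \<in> J \<or> X - A \<in> J" if "A \<subseteq> X" for A
  proof (rule ccontr)
    assume "\<not> (A \<in> J \<or> X - A \<in> J)"
    \<comment> \<open>If both \<open>A\<close> and \<open>X - A\<close> were outside
      \<open>J\<close>, both remainders of \<open>a\<close> would lie in \<open>J\<close>. As
      \<open>A\<close> and \<open>X - A\<close> are disjoint, the remainders cover
      \<open>a\<close>.\<close>
    then have "(a - A) \<union> (a - (X - A)) \<in> J"
      using that by (intro un extend) auto
    moreover have "a \<subseteq> (a - A) \<union> (a - (X - A))"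
      by auto
    ultimately show False
      using down \<open>a \<notin> J\<close> by blast
  qed
  with J that show thesis by blast
qed

text \<open>Each congruence in the intersection sends \<open>I\<close> to zero, which gives one
  inclusion. For the other, a prime ideal above \<open>I\<close> that avoids \<open>a\<close> yields
  a maximal congruence in the intersection that does not send \<open>a\<close> to zero.\<close>

lemma g_closed_powerset:
  assumes I: "semiring_ideal (powerset_semiring X) I"
  shows "g_closed (powerset_semiring X) I"
proof -
  let ?P = "powerset_semiring X"
  have "I \<subseteq> g_closure ?P I"
    using I by (auto simp: g_closure_def ideal_congruence_def zero_class_def
        semiring_ideal_powerset_iff)
  moreover have "a \<in> I" if a: "a \<in> g_closure ?P I" for a
  proof (rule ccontr)
    assume "a \<notin> I"
    have "a \<subseteq> X"
      using a by (simp add: g_closure_def zero_class_def)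
    then obtain J where J: "semiring_ideal ?P J" "I \<subseteq> J" "a \<notin> J"
        "\<And>A. A \<subseteq> X \<Longrightarrow> A \<in> J \<or> X - A \<in> J"
      using prime_ideal_avoiding_exists[OF I _ \<open>a \<notin> I\<close>] by blast
    let ?\<theta> = "sym_diff_congruence X J"
    have "X \<notin> J"
      using J(1,3) \<open>a \<subseteq> X\<close> by (auto simp: semiring_ideal_powerset_iff)
    then have "?\<theta> \<in> MaxCong ?P"
      using J by (intro sym_diff_congruence_in_MaxCong)
    \<comment> \<open>The zero-class of this congruence is \<open>J\<close> itself, because
      \<open>sym_diff A {}\<close> is \<open>A\<close>.\<close>
    moreover have "I \<subseteq> zero_class ?P ?\<theta>"
      using J(1,2) by (auto simp: zero_class_def sym_diff_congruence_def
          semiring_ideal_powerset_iff)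
    ultimately have "(a, {}) \<in> ?\<theta>"
      using a by (auto simp: g_closure_def zero_class_def ideal_congruence_def)
    then show False
      using J(3) by (simp add: sym_diff_congruence_def)
  qed
  ultimately show ?thesis
    by (auto simp: g_closed_def)
qed

theorem proposition9p6:
  fixes X :: "'a set"
  shows "(\<forall>\<rho>. semiring_congruence (powerset_semiring X) \<rho> \<longrightarrow>
            z_congruence (powerset_semiring X) \<rho>) \<and>
         (\<forall>I. semiring_ideal (powerset_semiring X) I \<longrightarrow>
            g_closed (powerset_semiring X) I)"
  using z_congruence_powerset g_closed_powerset by blast

end
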